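(* Let $2<r<\infty$. Then it is not the case that the Weyl transform $W_\sigma$ is (extends to) a bounded linear operator on $L^2(\mathbb{R}^2,\mathbb{Q})$ for all $\sigma\in L^r(\mathbb{R}^4,\mathbb{Q})$.
   Context: $\mathbb{Q}$ is the algebra of Hamilton quaternions with imaginary units $i,j,k$ ($i^2=j^2=k^2=ijk=-1$), conjugation $q\mapsto\bar q$ and modulus $|q|=\sqrt{q\bar q}$. $L^r(\mathbb{R}^n,\mathbb{Q})$ is the space of $\mathbb{Q}$-valued measurable functions $f$ with $\|f\|_r=(\int|f|^r)^{1/r}<\infty$, and $\mathcal{S}(\mathbb{R}^n,\mathbb{Q})$ is the space of $\mathbb{Q}$-valued Schwartz functions. The pairing is $\langle f,g\rangle=\int f\,\overline{g}$. For $f,g\in\mathcal{S}(\mathbb{R}^2,\mathbb{Q})$ the Wigner transform is $$W(f,g)(x,\xi)=\int_{\mathbb{R}^{2}} e^{-2\pi i \xi_1 p_1} f\left(x+\tfrac{p}{2}\right)\overline{g\left(x-\tfrac{p}{2}\right)} e^{-2\pi j \xi_2 p_2}\,dp,\qquad x,\xi\in\mathbb{R}^2.$$ The Weyl transform $W_\sigma$ with symbol $\sigma$ on $\mathbb{R}^4=\mathbb{R}^2\times\mathbb{R}^2$ is defined by $$\langle W_\sigma f,g\rangle=\int_{\mathbb{R}^2}\int_{\mathbb{R}^2}\sigma(x,\xi)\,W(f,g)(x,\xi)\,dx\,d\xi,\qquad f,g\in\mathcal{S}(\mathbb{R}^2,\mathbb{Q}).$$ *)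

theory Defs
  imports "HOL-Analysis.Analysis"
begin

section \<open>Hamilton quaternions\<close>

codatatype quat = Quat (qRe: real) (qIm1: real) (qIm2: real) (qIm3: real)

lemma quat_eqI [intro?]:
  "\<lbrakk>qRe x = qRe y; qIm1 x = qIm1 y; qIm2 x = qIm2 y; qIm3 x = qIm3 y\<rbrakk> \<Longrightarrow> x = y"
  by (rule quat.expand) simp

lemma quat_eq_iff:
  "x = y \<longleftrightarrow> qRe x = qRe y \<and> qIm1 x = qIm1 y \<and> qIm2 x = qIm2 y \<and> qIm3 x = qIm3 y"
  by (auto intro: quat.expand)

instantiation quat :: ab_group_add
begin

primcorec zero_quat where
  "qRe 0 = 0" | "qIm1 0 = 0" | "qIm2 0 = 0" | "qIm3 0 = 0"

primcorec plus_quat where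
  "qRe (x + y) = qRe x + qRe y"
| "qIm1 (x + y) = qIm1 x + qIm1 y"
| "qIm2 (x + y) = qIm2 x + qIm2 y"
| "qIm3 (x + y) = qIm3 x + qIm3 y"

primcorec uminus_quat where
  "qRe (- x) = - qRe x"
| "qIm1 (- x) = - qIm1 x"
| "qIm2 (- x) = - qIm2 x"
| "qIm3 (- x) = - qIm3 x"

primcorec minus_quat where
  "qRe (x - y) = qRe x - qRe y"
| "qIm1 (x - y) = qIm1 x - qIm1 y"
| "qIm2 (x - y) = qIm2 x - qIm2 y"
| "qIm3 (x - y) = qIm3 x - qIm3 y"

instance
  by standard (simp_all add: quat_eq_iff)

end

instantiation quat :: real_algebra_1
begin

primcorec one_quat where
  "qRe 1 = 1" | "qIm1 1 = 0" | "qIm2 1 = 0" | "qIm3 1 = 0"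

primcorec times_quat where
  "qRe (x * y) = qRe x * qRe y - qIm1 x * qIm1 y - qIm2 x * qIm2 y - qIm3 x * qIm3 y"
| "qIm1 (x * y) = qRe x * qIm1 y + qIm1 x * qRe y + qIm2 x * qIm3 y - qIm3 x * qIm2 y"
| "qIm2 (x * y) = qRe x * qIm2 y - qIm1 x * qIm3 y + qIm2 x * qRe y + qIm3 x * qIm1 y"
| "qIm3 (x * y) = qRe x * qIm3 y + qIm1 x * qIm2 y - qIm2 x * qIm1 y + qIm3 x * qRe y"

primcorec scaleR_quat where
  "qRe (scaleR r x) = r * qRe x"
| "qIm1 (scaleR r x) = r * qIm1 x"
| "qIm2 (scaleR r x) = r * qIm2 x"
| "qIm3 (scaleR r x) = r * qIm3 x"

instance
  by standard (simp_all add: quat_eq_iff algebra_simps)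

end

primcorec qcnj :: "quat \<Rightarrow> quat" where
  "qRe (qcnj x) = qRe x"
| "qIm1 (qcnj x) = - qIm1 x"
| "qIm2 (qcnj x) = - qIm2 x"
| "qIm3 (qcnj x) = - qIm3 x"

definition qi :: quat where "qi = Quat 0 1 0 0"
definition qj :: quat where "qj = Quat 0 0 1 0"
definition qk :: quat where "qk = Quat 0 0 0 1"

lemma quat_unit_relations:
  "qi * qi = -1" "qj * qj = -1" "qk * qk = -1" "qi * qj * qk = -1"
  by (simp_all add: qi_def qj_def qk_def quat_eq_iff)

instantiation quat :: real_inner
begin

definition inner_quat :: "quat \<Rightarrow> quat \<Rightarrow> real" where
  "inner_quat x y = qRe x * qRe y + qIm1 x * qIm1 y + qIm2 x * qIm2 y + qIm3 x * qIm3 y"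

definition norm_quat :: "quat \<Rightarrow> real" where
  "norm_quat x = sqrt ((qRe x)\<^sup>2 + (qIm1 x)\<^sup>2 + (qIm2 x)\<^sup>2 + (qIm3 x)\<^sup>2)"

definition sgn_quat :: "quat \<Rightarrow> quat" where
  "sgn_quat x = x /\<^sub>R norm x"

definition dist_quat :: "quat \<Rightarrow> quat \<Rightarrow> real" where
  "dist_quat x y = norm (x - y)"

definition uniformity_quat :: "(quat \<times> quat) filter" where
  "uniformity_quat = (INF e\<in>{0 <..}. principal {(x, y). dist x y < e})"

definition open_quat :: "quat set \<Rightarrow> bool" where
  "open_quat U \<longleftrightarrow> (\<forall>x\<in>U. eventually (\<lambda>(x', y). x' = x \<longrightarrow> y \<in> U) uniformity)"

instance
proof
  fix x y z :: quat and r :: real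
  show "inner x x = 0 \<longleftrightarrow> x = 0"
    by (simp add: inner_quat_def quat_eq_iff add_nonneg_eq_0_iff)
qed (simp_all add: inner_quat_def norm_quat_def sgn_quat_def dist_quat_def uniformity_quat_def
      open_quat_def algebra_simps power2_eq_square)

end

lemma norm_quat_power2: "(norm x)\<^sup>2 = (qRe x)\<^sup>2 + (qIm1 x)\<^sup>2 + (qIm2 x)\<^sup>2 + (qIm3 x)\<^sup>2"
  for x :: quat
  by (simp add: norm_quat_def)

lemma mult_qcnj: "q * qcnj q = of_real ((norm q)\<^sup>2)"
  unfolding norm_quat_power2 by (simp add: quat_eq_iff of_real_def power2_eq_square)

lemma qcnj_mult_self: "qcnj q * q = of_real ((norm q)\<^sup>2)"
  unfolding norm_quat_power2 by (simp add: quat_eq_iff of_real_def power2_eq_square)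

instantiation quat :: real_normed_div_algebra
begin

definition inverse_quat :: "quat \<Rightarrow> quat" where
  "inverse_quat q = qcnj q /\<^sub>R (norm q)\<^sup>2"

definition divide_quat_def:
  "x div y = x * inverse y" for x y :: quat

instance
proof
  fix x y :: quat
  show "x \<noteq> 0 \<Longrightarrow> inverse x * x = 1" "x \<noteq> 0 \<Longrightarrow> x * inverse x = 1"
    by (simp_all add: inverse_quat_def mult_qcnj qcnj_mult_self of_real_def)
  show "x div y = x * inverse y"
    by (rule divide_quat_def)
  show "inverse (0::quat) = 0"
    by (simp add: inverse_quat_def quat_eq_iff)
  have "(norm (x * y))\<^sup>2 = (norm x * norm y)\<^sup>2"
    unfolding power_mult_distrib norm_quat_power2 times_quat.simps by (simp add: power2_eq_square algebra_simps)
  then show "norm (x * y) = norm x * norm y"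
    by (rule power2_eq_imp_eq) simp_all
qed

end

instantiation quat :: euclidean_space
begin

definition Basis_quat :: "quat set" where
  "Basis_quat = {1, qi, qj, qk}"

instance
proof
  have distinct: "1 \<noteq> qi" "1 \<noteq> qj" "1 \<noteq> qk" "qi \<noteq> qj" "qi \<noteq> qk" "qj \<noteq> qk"
    by (simp_all add: quat_eq_iff qi_def qj_def qk_def)
  have inner_unit: "inner x 1 = qRe x" "inner x qi = qIm1 x" "inner x qj = qIm2 x" "inner x qk = qIm3 x"
    for x :: quat
    by (simp_all add: inner_quat_def qi_def qj_def qk_def)
  show "inner u v = (if u = v then 1 else 0)" if "u \<in> Basis" "v \<in> Basis" for u v :: quat
    using that distinct unfolding Basis_quat_def insert_iff empty_iff
    by (elim disjE) (simp_all add: inner_quat_def qi_def qj_def qk_def)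
  show "(\<forall>u\<in>Basis. inner x u = 0) \<longleftrightarrow> x = 0" for x :: quat
    by (simp add: Basis_quat_def inner_unit quat_eq_iff)
qed (simp_all add: Basis_quat_def)

end

lemma norm_quat_eq_sqrt: "norm q = sqrt (qRe (q * qcnj q))"
  by (simp add: norm_quat_def power2_eq_square)


section \<open>Schwartz functions\<close>

fun iter_partial :: "'a list \<Rightarrow> ('a::real_normed_vector \<Rightarrow> 'b::real_normed_vector) \<Rightarrow> 'a \<Rightarrow> 'b" where
  "iter_partial [] f = f"
| "iter_partial (b # bs) f = (\<lambda>x. frechet_derivative (iter_partial bs f) (at x) b)"

definition schwartz :: "('a::euclidean_space \<Rightarrow> 'b::real_normed_vector) set" where
  "schwartz = {f. \<forall>bs. set bs \<subseteq> Basis \<longrightarrow>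
      (\<forall>x. iter_partial bs f differentiable (at x)) \<and>
      (\<forall>N::nat. \<exists>C. \<forall>x. norm x ^ N * norm (iter_partial bs f x) \<le> C)}"


section \<open>Lebesgue spaces and bounded operators on them\<close>

definition Lp_norm :: "real \<Rightarrow> ('a::euclidean_space \<Rightarrow> quat) \<Rightarrow> real" where
  "Lp_norm r f = (\<integral>x. norm (f x) powr r \<partial>lborel) powr (1 / r)"

definition Lp_space :: "real \<Rightarrow> ('a::euclidean_space \<Rightarrow> quat) set" where
  "Lp_space r = {f. f \<in> borel_measurable lborel \<and> integrable lborel (\<lambda>x. norm (f x) powr r)}"

definition pairing :: "('a::euclidean_space \<Rightarrow> quat) \<Rightarrow> ('a \<Rightarrow> quat) \<Rightarrow> quat" where
  "pairing f g = (\<integral>x. f x * qcnj (g x) \<partial>lborel)"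

text \<open>Elements of \<open>L\<^sup>2\<close> are represented by functions, so linearity is required up to null sets;
  linearity and the norm bound make \<open>T\<close> respect equality almost everywhere.
  Linearity is over the reals.\<close>

definition bounded_linear_L2 ::
    "(('a::euclidean_space \<Rightarrow> quat) \<Rightarrow> ('a \<Rightarrow> quat)) \<Rightarrow> bool" where
  "bounded_linear_L2 T \<longleftrightarrow>
     (\<forall>f\<in>Lp_space 2. T f \<in> Lp_space 2) \<and>
     (\<forall>f\<in>Lp_space 2. \<forall>g\<in>Lp_space 2.
        AE x in lborel. T (\<lambda>y. f y + g y) x = T f x + T g x) \<and>
     (\<forall>c. \<forall>f\<in>Lp_space 2. AE x in lborel. T (\<lambda>y. c *\<^sub>R f y) x = c *\<^sub>R T f x) \<and>
     (\<exists>C. \<forall>f\<in>Lp_space 2. Lp_norm 2 (T f) \<le> C * Lp_norm 2 f)"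


section \<open>Wigner and Weyl transforms\<close>

definition wigner :: "(real^2 \<Rightarrow> quat) \<Rightarrow> (real^2 \<Rightarrow> quat) \<Rightarrow> real^2 \<Rightarrow> real^2 \<Rightarrow> quat" where
  "wigner f g x \<xi> =
     (\<integral>p. exp ((- 2 * pi * \<xi>$1 * p$1) *\<^sub>R qi) * f (x + p /\<^sub>R 2) * qcnj (g (x - p /\<^sub>R 2))
           * exp ((- 2 * pi * \<xi>$2 * p$2) *\<^sub>R qj) \<partial>lborel)"

definition weyl_form ::
    "((real^2) \<times> (real^2) \<Rightarrow> quat) \<Rightarrow> (real^2 \<Rightarrow> quat) \<Rightarrow> (real^2 \<Rightarrow> quat) \<Rightarrow> quat" where
  "weyl_form \<sigma> f g = (\<integral>\<xi>. (\<integral>x. \<sigma> (x, \<xi>) * wigner f g x \<xi> \<partial>lborel) \<partial>lborel)"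

definition weyl_extends_bounded :: "((real^2) \<times> (real^2) \<Rightarrow> quat) \<Rightarrow> bool" where
  "weyl_extends_bounded \<sigma> \<longleftrightarrow>
     (\<exists>T. bounded_linear_L2 T \<and> (\<forall>f\<in>schwartz. \<forall>g\<in>schwartz. pairing (T f) g = weyl_form \<sigma> f g))"

text \<open>A form \<open>g \<mapsto> \<langle>h, g\<rangle>\<close> satisfies \<open>\<langle>h, q g\<rangle> = \<langle>h, g\<rangle> qcnj q\<close>, whereas
  \<open>weyl_form \<sigma> f\<close> need not, because of the exponential factor on the right in the Wigner transform.
  Hence \<open>weyl_extends_bounded\<close> can fail for purely algebraic reasons. The following is the
  \<open>L\<^sup>2\<close>-boundedness of the Weyl transform as a form. It does not depend on representability and,
  by Cauchy-Schwarz, is implied by \<open>weyl_extends_bounded\<close>.\<close>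

definition weyl_form_bounded :: "((real^2) \<times> (real^2) \<Rightarrow> quat) \<Rightarrow> bool" where
  "weyl_form_bounded \<sigma> \<longleftrightarrow>
     (\<exists>C. \<forall>f\<in>schwartz. \<forall>g\<in>schwartz. norm (weyl_form \<sigma> f g) \<le> C * Lp_norm 2 f * Lp_norm 2 g)"

end

theory Submission
  imports Defs "HOL-Real_Asymp.Real_Asymp"
begin

text \<open>Let \<open>\<phi>\<close> be a smooth bump supported in the unit square, \<open>f\<close> the sum of its \<open>N\<close> translates by
  \<open>(2 j, 0)\<close>, and \<open>g\<close> the sum of its \<open>N\<close> translates by \<open>(0, 2 k)\<close>. The cross-Wigner transform of the
  \<open>j\<close>-th and \<open>k\<close>-th bumps lives over the unit square with corner \<open>(j, k)\<close>, so the \<open>N\<^sup>2\<close> pieces of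
  \<open>W(f, g)\<close> do not overlap and, up to phases, are translates of \<open>W(\<phi>, \<phi>)\<close>. Hence a symbol whose
  phases cancel those of the pieces and whose modulus on the square \<open>(j, k)\<close> is
  \<open>((1 + x\<^sub>1) (1 + x\<^sub>2))\<^bsup>-s\<^esup>\<close>, cut off to small \<open>\<xi>\<close>, gives a form of size at least a constant times
  \<open>N\<^bsup>2 - 2 s\<^esup>\<close> at \<open>(f, g)\<close>, whereas \<open>\<parallel>f\<parallel>\<^sub>2 \<parallel>g\<parallel>\<^sub>2\<close> is of order \<open>N\<close>. Such a symbol is in \<open>L\<^sup>r\<close> when
  \<open>s > 1 / r\<close> and yields an unbounded form when \<open>s < 1 / 2\<close>; for \<open>r > 2\<close> both are possible.\<close>

section \<open>Smooth compactly supported functions on the line\<close>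

text \<open>Coinduction encodes derivatives of all orders at once: a member has a derivative that is
  again a member. The support radius may change with each differentiation.\<close>

coinductive test_fun :: "(real \<Rightarrow> real) \<Rightarrow> bool" where
  test_funI: "\<lbrakk>\<And>t. (u has_real_derivative u' t) (at t); \<And>t. \<bar>t\<bar> > R \<Longrightarrow> u t = 0; test_fun u'\<rbrakk> \<Longrightarrow> test_fun u"

lemma test_fun_continuous: "test_fun u \<Longrightarrow> continuous_on A u"
  by (metis test_fun.cases DERIV_continuous_on has_field_derivative_at_within)

lemma test_fun_bounds:
  assumes "test_fun u"
  obtains R M where "\<And>t. \<bar>t\<bar> > R \<Longrightarrow> u t = 0" "\<And>t. \<bar>u t\<bar> \<le> M" "0 \<le> R"
proof -
  obtain R where R: "\<And>t. \<bar>t\<bar> > R \<Longrightarrow> u t = 0"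
    using assms by (cases rule: test_fun.cases) blast
  have "compact (u ` {-R..R})"
    by (intro compact_continuous_image test_fun_continuous assms) simp
  then have "\<exists>M. \<forall>t\<in>{-R..R}. \<bar>u t\<bar> \<le> M"
    using compact_imp_bounded by (force simp: bounded_iff)
  then obtain M where M: "\<And>t. t \<in> {-R..R} \<Longrightarrow> \<bar>u t\<bar> \<le> M" by blast
  show ?thesis
  proof
    show "u t = 0" if "\<bar>t\<bar> > max R 0" for t using R that by auto
    show "\<bar>u t\<bar> \<le> max M 0" for t
    proof (cases "\<bar>t\<bar> > R")
      case False
      then have "t \<in> {-R..R}" by auto
      from M[OF this] show ?thesis by simp
    qed (simp add: R)
  qed simp
qed

text \<open>Differentiation commutes with shifts and finite sums, so the functions of this shape
  form a class closed under differentiation. That class is the coinduction invariant.\<close>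

lemma test_fun_sum_shift:
  assumes "test_fun u"
  shows "test_fun (\<lambda>t. \<Sum>j<N. u (t - 2 * real j))"
proof (rule test_fun.coinduct[of "\<lambda>w. \<exists>v. test_fun v \<and> w = (\<lambda>t. \<Sum>j<N. v (t - 2 * real j))"])
  fix w :: "real \<Rightarrow> real"
  assume "\<exists>v. test_fun v \<and> w = (\<lambda>t. \<Sum>j<N. v (t - 2 * real j))"
  then obtain v where v: "test_fun v" and w: "w = (\<lambda>t. \<Sum>j<N. v (t - 2 * real j))" by blast
  from v obtain v' R where v': "\<And>t. (v has_real_derivative v' t) (at t)"
    and R: "\<And>t. \<bar>t\<bar> > R \<Longrightarrow> v t = 0" and "test_fun v'"
    by (cases rule: test_fun.cases) blast
  have "(w has_real_derivative (\<Sum>j<N. v' (t - 2 * real j))) (at t)" for t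
    unfolding w by (auto intro!: derivative_eq_intros DERIV_chain2[OF v'])
  moreover have "w t = 0" if "\<bar>t\<bar> > R + 2 * real N" for t
    unfolding w using that by (intro sum.neutral ballI R) auto
  ultimately show "\<exists>u u' R. w = u \<and> (\<forall>t. (u has_real_derivative u' t) (at t)) \<and>
      (\<forall>t. R < \<bar>t\<bar> \<longrightarrow> u t = 0) \<and>
      ((\<exists>v. test_fun v \<and> u' = (\<lambda>t. \<Sum>j<N. v (t - 2 * real j))) \<or> test_fun u')"
    using \<open>test_fun v'\<close>
    by (intro exI[of _ w] exI[of _ "\<lambda>t. \<Sum>j<N. v' (t - 2 * real j)"] exI[of _ "R + 2 * real N"]) blast
qed (use assms in blast)

text \<open>Up to the polynomial factor, \<open>bump_fam Q k\<close> is \<open>u\<^sup>k exp (- u)\<close> with \<open>u = 1 / (t (1 - t))\<close>; since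
  \<open>u' = - (1 - 2 t) u\<^sup>2\<close>, this family is closed under differentiation.\<close>

definition bump_fam :: "real poly \<Rightarrow> nat \<Rightarrow> real \<Rightarrow> real" where
  "bump_fam Q k t = (if 0 < t \<and> t < 1
     then poly Q t * (1 / (t * (1 - t))) ^ k * exp (- (1 / (t * (1 - t)))) else 0)"

text \<open>The derivative of \<open>Q u^k exp (- u)\<close> is \<open>((1 - 2 t) Q u^(k+2) + Q' u^k
  - k (1 - 2 t) Q u^(k+1)) exp (- u)\<close>. Powers of \<open>t (1 - t) = 1 / u\<close> bring all
  three terms to the common factor \<open>u^(k+2)\<close>.\<close>

definition bump_step :: "real poly \<Rightarrow> nat \<Rightarrow> real poly" where
  "bump_step Q k = [:1, -2:] * Q + pderiv Q * [:0, 1, -1:]\<^sup>2 - smult (real k) ([:1, -2:] * Q * [:0, 1, -1:])"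

text \<open>A single term of the exponential series gives \<open>u^(k+2) \<le> (k+2)! exp u\<close>,
  which leaves two spare powers of \<open>1 / u = t (1 - t)\<close>. This second-order vanishing at
  0 and 1 forces the derivatives there to be 0.\<close>

lemma bump_fam_quadratic_bound:
  obtains C where "\<And>t. \<bar>bump_fam Q k t\<bar> \<le> C * (t * (1 - t))\<^sup>2"
proof -
  have "compact (poly Q ` {0..1})"
    by (intro compact_continuous_image continuous_intros) simp
  then have "\<exists>M. \<forall>t\<in>{0..1}. \<bar>poly Q t\<bar> \<le> M"
    using compact_imp_bounded by (force simp: bounded_iff)
  then obtain M where M: "\<And>t. t \<in> {0..1} \<Longrightarrow> \<bar>poly Q t\<bar> \<le> M" by blast
  have M0: "0 \<le> M" using M[of 0] by simp
  have "\<bar>bump_fam Q k t\<bar> \<le> M * fact (k + 2) * (t * (1 - t))\<^sup>2" for t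
  proof (cases "0 < t \<and> t < 1")
    case True
    define u where "u = 1 / (t * (1 - t))"
    have u: "u > 0" using True by (simp add: u_def)
    have "u ^ (k + 2) / fact (k + 2) \<le> exp u"
      using u sum_le_suminf[OF summable_exp_generic[of u], of "{k + 2}"] by (simp add: exp_def divide_inverse mult.commute)
    then have e: "u ^ (k + 2) \<le> fact (k + 2) * exp u"
      by (subst (asm) pos_divide_le_eq) (simp_all only: fact_gt_zero mult.commute)
    have "u ^ k * exp (- u) = u ^ (k + 2) * (exp (- u) * (1 / u)\<^sup>2)"
      using u by (simp add: power_add power2_eq_square)
    also have "\<dots> \<le> fact (k + 2) * exp u * (exp (- u) * (1 / u)\<^sup>2)"
      by (rule mult_right_mono[OF e]) simp
    also have "\<dots> = fact (k + 2) * (1 / u)\<^sup>2"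
      by (simp add: exp_minus del: fact_Suc)
    finally have "u ^ k * exp (- u) \<le> fact (k + 2) * (1 / u)\<^sup>2" .
    then have "\<bar>poly Q t\<bar> * (u ^ k * exp (- u)) \<le> M * (fact (k + 2) * (1 / u)\<^sup>2)"
      using M[of t] True u M0 by (intro mult_mono[of _ M "u ^ k * exp (- u)"]) auto
    then show ?thesis
      using True u by (simp add: bump_fam_def u_def[symmetric] abs_mult) (simp add: u_def mult_ac)
  qed (auto simp: bump_fam_def M0)
  then show ?thesis by (rule that)
qed

lemma bump_fam_deriv: "(bump_fam Q k has_real_derivative bump_fam (bump_step Q k) (k + 2) t) (at t)"
proof -
  consider "0 < t \<and> t < 1" | "t = 0 \<or> t = 1" | "t < 0 \<or> t > 1" by linarith
  then show ?thesis
  proof cases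
    case 1
    define u where "u s = 1 / (s * (1 - s))" for s :: real
    have nz: "t \<noteq> 0" "1 - t \<noteq> 0" using 1 by auto
    have du: "(u has_real_derivative - (1 - 2 * t) * (u t)\<^sup>2) (at t)"
      unfolding u_def using nz
      by (auto intro!: derivative_eq_intros simp: divide_simps power2_eq_square)
    have w: "u t * (t * (1 - t)) = 1" using nz by (simp add: u_def)
    have pw: "poly [:0, 1, -1:] t = t * (1 - t)" by (simp add: algebra_simps)
    have step: "poly (bump_step Q k) t * u t ^ (k + 2) =
      (1 - 2 * t) * poly Q t * u t ^ (k + 2) + poly (pderiv Q) t * u t ^ k
        - real k * (1 - 2 * t) * poly Q t * u t ^ (k + 1)" (is "?l = ?r")
    proof -
      have "?l = (1 - 2 * t) * poly Q t * u t ^ (k + 2) + poly (pderiv Q) t * u t ^ k * (u t * (t * (1 - t)))\<^sup>2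
        - real k * (1 - 2 * t) * poly Q t * u t ^ (k + 1) * (u t * (t * (1 - t)))"
        unfolding bump_step_def poly_diff poly_add poly_mult poly_smult poly_power pw
        by (simp add: algebra_simps power2_eq_square)
      then show ?thesis by (simp add: w)
    qed
    have "((\<lambda>s. poly Q s * u s ^ k * exp (- u s)) has_real_derivative
        poly (bump_step Q k) t * u t ^ (k + 2) * exp (- u t)) (at t)"
      unfolding step
      apply (rule derivative_eq_intros du poly_DERIV refl)+
      by (cases k) (simp_all add: algebra_simps power2_eq_square)
    moreover have "\<forall>\<^sub>F s in nhds t. s \<in> {0<..<1}"
      using 1 by (intro eventually_nhds_in_open) auto
    then have "\<forall>\<^sub>F s in nhds t. bump_fam Q k s = poly Q s * u s ^ k * exp (- u s)"
      by eventually_elim (simp add: bump_fam_def u_def)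
    ultimately show ?thesis
      using 1 by (subst DERIV_cong_ev[OF refl _ refl]) (auto simp: bump_fam_def u_def)
  next
    case 2
    obtain C where C: "\<And>t. \<bar>bump_fam Q k t\<bar> \<le> C * (t * (1 - t))\<^sup>2"
      by (rule bump_fam_quadratic_bound) blast
    have z: "bump_fam Q' k' t = 0" for Q' k' using 2 by (auto simp: bump_fam_def)
    have "((\<lambda>s. bump_fam Q k s / (s - t)) \<longlongrightarrow> 0) (at t)"
    proof (rule Lim_null_comparison)
      show "\<forall>\<^sub>F s in at t. norm (bump_fam Q k s / (s - t)) \<le> C * \<bar>s - t\<bar> * (s - (1 - t))\<^sup>2"
        unfolding eventually_at_filter
      proof (intro always_eventually allI impI)
        fix s assume "s \<noteq> t"
        \<comment> \<open>As \<open>t\<close> is 0 or 1, the other endpoint is \<open>1 - t\<close>.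
          One factor |s - t| cancels against the difference quotient and the other tends to
          0.\<close>
        have "(s * (1 - s))\<^sup>2 = \<bar>s - t\<bar> * \<bar>s - t\<bar> * (s - (1 - t))\<^sup>2"
          using 2 by (auto simp: power2_eq_square algebra_simps)
        then show "norm (bump_fam Q k s / (s - t)) \<le> C * \<bar>s - t\<bar> * (s - (1 - t))\<^sup>2"
          using C[of s] \<open>s \<noteq> t\<close> by (simp add: pos_divide_le_eq mult_ac)
      qed
      have "((\<lambda>s. C * \<bar>s - t\<bar> * (s - (1 - t))\<^sup>2) \<longlongrightarrow> C * \<bar>t - t\<bar> * (t - (1 - t))\<^sup>2) (at t)"
        by (intro tendsto_intros)
      then show "((\<lambda>s. C * \<bar>s - t\<bar> * (s - (1 - t))\<^sup>2) \<longlongrightarrow> 0) (at t)" by simp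
    qed
    then show ?thesis by (simp add: has_field_derivative_iff z)
  next
    case 3
    have "\<forall>\<^sub>F s in nhds t. s \<in> {..<0} \<union> {1<..}"
      using 3 by (intro eventually_nhds_in_open) auto
    then have "\<forall>\<^sub>F s in nhds t. bump_fam Q k s = 0"
      by eventually_elim (auto simp: bump_fam_def)
    then show ?thesis
      using 3 by (subst DERIV_cong_ev[OF refl _ refl]) (auto simp: bump_fam_def)
  qed
qed

lemma test_fun_bump_fam: "test_fun (bump_fam Q k)"
proof (coinduction arbitrary: Q k)
  case test_fun
  have "\<And>t. \<bar>t\<bar> > 1 \<Longrightarrow> bump_fam Q k t = 0" by (auto simp: bump_fam_def)
  then show ?case using bump_fam_deriv[of Q k] by blast
qed

section \<open>Tensor products of test functions are Schwartz\<close>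

lemma tensor_has_derivative:
  fixes u v :: "real \<Rightarrow> real"
  assumes "\<And>t. (u has_real_derivative u' t) (at t)" "\<And>t. (v has_real_derivative v' t) (at t)"
  shows "((\<lambda>x::real^2. of_real (u (x$1) * v (x$2)) :: quat) has_derivative
     (\<lambda>h. of_real (u' (x$1) * h$1 * v (x$2) + u (x$1) * (v' (x$2) * h$2)))) (at x)"
proof -
  have c: "((\<lambda>x::real^2. x$i) has_derivative (\<lambda>h. h$i)) (at x)" for i
    by (rule bounded_linear_imp_has_derivative[OF bounded_linear_vec_nth])
  have u: "((\<lambda>x::real^2. u (x$1)) has_derivative (\<lambda>h. u' (x$1) * h$1)) (at x)"
    using has_derivative_compose[OF c, of u "(*) (u' (x$1))" 1] assms(1)
    by (simp add: has_field_derivative_def)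
  have v: "((\<lambda>x::real^2. v (x$2)) has_derivative (\<lambda>h. v' (x$2) * h$2)) (at x)"
    using has_derivative_compose[OF c, of v "(*) (v' (x$2))" 2] assms(2)
    by (simp add: has_field_derivative_def)
  show ?thesis
    using bounded_linear.has_derivative[OF bounded_linear_of_real has_derivative_mult[OF u v]]
    by (simp add: algebra_simps)
qed

text \<open>A basis direction differentiates only one of the two factors, so the tensor form
  persists through all iterated partial derivatives.\<close>

lemma tensor_partial:
  assumes "test_fun u" "test_fun v" "set bs \<subseteq> Basis"
  shows "\<exists>u' v'. test_fun u' \<and> test_fun v' \<and>
     iter_partial bs (\<lambda>x::real^2. of_real (u (x$1) * v (x$2)) :: quat) = (\<lambda>x. of_real (u' (x$1) * v' (x$2)))"
  using assms(3)
proof (induction bs)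
  case Nil
  then show ?case using assms(1,2) by auto
next
  case (Cons b bs)
  then obtain p q where p: "test_fun p" and q: "test_fun q" and
    eq: "iter_partial bs (\<lambda>x::real^2. of_real (u (x$1) * v (x$2)) :: quat) = (\<lambda>x. of_real (p (x$1) * q (x$2)))"
    by auto
  from p obtain p' where p': "\<And>t. (p has_real_derivative p' t) (at t)" "test_fun p'"
    by (cases rule: test_fun.cases) blast
  from q obtain q' where q': "\<And>t. (q has_real_derivative q' t) (at t)" "test_fun q'"
    by (cases rule: test_fun.cases) blast
  have fd: "iter_partial (b # bs) (\<lambda>x::real^2. of_real (u (x$1) * v (x$2)) :: quat) =
      (\<lambda>x. of_real (p' (x$1) * b$1 * q (x$2) + p (x$1) * (q' (x$2) * b$2)))"
    unfolding iter_partial.simps eq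
    by (subst frechet_derivative_at[symmetric, OF tensor_has_derivative[OF p'(1) q'(1)]]) simp
  have "b \<in> Basis" using Cons.prems by simp
  then have "b = axis 1 1 \<or> b = axis 2 1"
    by (auto simp: Basis_vec_def) (metis exhaust_2)
  then show ?case
  proof
    assume "b = axis 1 1"
    then show ?thesis using fd p'(2) q by (auto simp: axis_def)
  next
    assume "b = axis 2 1"
    then show ?thesis using fd q'(2) p by (auto simp: axis_def)
  qed
qed

lemma norm_le_R2: "norm (x::real^2) \<le> \<bar>x$1\<bar> + \<bar>x$2\<bar>"
  using norm_le_l1_cart[of x] by (simp add: sum_2)

text \<open>Each iterated partial derivative is again a tensor product of test functions, hence
  bounded and supported in a rectangle, on which \<open>norm x ^ N\<close> is bounded as
  well.\<close>

lemma schwartz_tensor: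
  assumes "test_fun u" "test_fun v"
  shows "(\<lambda>x::real^2. of_real (u (x$1) * v (x$2)) :: quat) \<in> schwartz"
  unfolding schwartz_def
proof (intro CollectI allI impI conjI)
  fix bs :: "(real^2) list" and x :: "real^2" and N :: nat
  assume "set bs \<subseteq> Basis"
  then obtain p q where p: "test_fun p" and q: "test_fun q" and
    eq: "iter_partial bs (\<lambda>x::real^2. of_real (u (x$1) * v (x$2)) :: quat) = (\<lambda>x. of_real (p (x$1) * q (x$2)))"
    using tensor_partial[OF assms] by blast
  from p obtain p' where p': "\<And>t. (p has_real_derivative p' t) (at t)"
    by (cases rule: test_fun.cases) blast
  from q obtain q' where q': "\<And>t. (q has_real_derivative q' t) (at t)"
    by (cases rule: test_fun.cases) blast
  show "iter_partial bs (\<lambda>x::real^2. of_real (u (x$1) * v (x$2)) :: quat) differentiable at x"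
    unfolding eq using tensor_has_derivative[OF p' q'] by (auto simp: differentiable_def)
  obtain R1 M1 where 1: "\<And>t. \<bar>t\<bar> > R1 \<Longrightarrow> p t = 0" "\<And>t. \<bar>p t\<bar> \<le> M1" "0 \<le> R1"
    using test_fun_bounds[OF p] by blast
  obtain R2 M2 where 2: "\<And>t. \<bar>t\<bar> > R2 \<Longrightarrow> q t = 0" "\<And>t. \<bar>q t\<bar> \<le> M2" "0 \<le> R2"
    using test_fun_bounds[OF q] by blast
  have M: "0 \<le> M1" "0 \<le> M2" using 1(2)[of 0] 2(2)[of 0] by auto
  have "norm x ^ N * norm (of_real (p (x$1) * q (x$2)) :: quat) \<le> (R1 + R2) ^ N * (M1 * M2)" for x :: "real^2"
  proof (cases "\<bar>x$1\<bar> > R1 \<or> \<bar>x$2\<bar> > R2")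
    case True
    then have "p (x$1) * q (x$2) = 0" using 1(1) 2(1) by auto
    then have n0: "norm (of_real (p (x$1) * q (x$2)) :: quat) = 0" by simp
    then show ?thesis unfolding n0 using 1 2 M by simp
  next
    case False
    then have "norm x \<le> R1 + R2" using norm_le_R2[of x] by linarith
    then show ?thesis
      using 1 2 M by (intro mult_mono power_mono) (auto simp: abs_mult norm_mult intro!: mult_mono)
  qed
  then show "\<exists>C. \<forall>x. norm x ^ N * norm (iter_partial bs (\<lambda>x::real^2. of_real (u (x$1) * v (x$2)) :: quat) x) \<le> C"
    unfolding eq by blast
qed

section \<open>Integration on Euclidean space\<close>

lemma lborel_integral_shift:
  fixes f :: "'a::euclidean_space \<Rightarrow> 'b::{banach, second_countable_topology}"
  assumes [measurable]: "f \<in> borel_measurable borel"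
  shows "(\<integral>x. f (x + a) \<partial>lborel) = (\<integral>x. f x \<partial>lborel)"
proof -
  have "(\<integral>x. f x \<partial>lborel) = (\<integral>x. f x \<partial>distr lborel borel ((+) a))"
    by (simp add: lborel_distr_plus)
  also have "\<dots> = (\<integral>x. f (a + x) \<partial>lborel)"
    by (rule integral_distr) auto
  finally show ?thesis by (simp add: add.commute)
qed

lemma integrable_compact_support:
  fixes f :: "'a::euclidean_space \<Rightarrow> 'b::{banach, second_countable_topology}"
  assumes "continuous_on UNIV f" "\<And>x. norm x > R \<Longrightarrow> f x = 0"
  shows "integrable lborel f"
proof -
  have "integrable lborel (\<lambda>x. indicator (cball 0 R) x *\<^sub>R f x)"
    by (rule borel_integrable_compact[OF compact_cball continuous_on_subset[OF assms(1)]]) simp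
  moreover have "(\<lambda>x. indicator (cball 0 R) x *\<^sub>R f x) = f"
    using assms(2) by (force simp: indicator_def)
  ultimately show ?thesis by simp
qed

lemma integrable_lborel_pair_mult:
  fixes f :: "'a::euclidean_space \<Rightarrow> real" and g :: "'b::euclidean_space \<Rightarrow> real"
  assumes f: "integrable lborel f" and g: "integrable lborel g"
  shows "integrable (lborel \<Otimes>\<^sub>M lborel) (\<lambda>z. f (fst z) * g (snd z))"
proof (rule lborel_pair.Fubini_integrable)
  have [measurable]: "f \<in> borel_measurable borel" "g \<in> borel_measurable borel" using f g by auto
  show "(\<lambda>z. f (fst z) * g (snd z)) \<in> borel_measurable (lborel \<Otimes>\<^sub>M lborel)" by measurable
qed (use f g in \<open>simp_all add: abs_mult\<close>)

text \<open>The change of variables from \<open>(x, p)\<close> to \<open>(x + p/2, x - p/2)\<close>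
  preserves the measure; here it is carried out by Fubini and translations alone. It computes the
  total integral of the modulus of the Wigner integrand.\<close>

lemma midpoint_integral:
  fixes f g :: "'a::euclidean_space \<Rightarrow> real"
  assumes cf: "continuous_on UNIV f" and cg: "continuous_on UNIV g"
    and sf: "\<And>x. norm x > R \<Longrightarrow> f x = 0" and sg: "\<And>x. norm x > R \<Longrightarrow> g x = 0"
  shows "integrable lborel (\<lambda>p. f (x + p /\<^sub>R 2) * g (x - p /\<^sub>R 2))"
    and "integrable lborel (\<lambda>x. \<integral>p. f (x + p /\<^sub>R 2) * g (x - p /\<^sub>R 2) \<partial>lborel)"
    and "(\<integral>x. (\<integral>p. f (x + p /\<^sub>R 2) * g (x - p /\<^sub>R 2) \<partial>lborel) \<partial>lborel) =
           (\<integral>x. f x \<partial>lborel) * (\<integral>x. g x \<partial>lborel)"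
proof -
  have [measurable]: "f \<in> borel_measurable borel" "g \<in> borel_measurable borel"
    using cf cg by (auto intro: borel_measurable_continuous_onI)
  have c: "continuous_on UNIV (\<lambda>z::'c::t2_space. f (h z))" "continuous_on UNIV (\<lambda>z::'c::t2_space. g (h z))"
    if "continuous_on UNIV h" for h
    using continuous_on_compose2[OF cf that] continuous_on_compose2[OF cg that] by auto
  \<comment> \<open>\<open>x\<close> is the midpoint and \<open>p\<close> the difference of two
    points of the ball of radius \<open>R\<close>. The radius \<open>3 * R\<close> below is the sum
    of the two bounds.\<close>
  have supp: "norm x \<le> R \<and> norm p \<le> 2 * R" if "f (x + p /\<^sub>R 2) * g (x - p /\<^sub>R 2) \<noteq> 0" for x p
  proof -
    have *: "norm (x + p /\<^sub>R 2) \<le> R" "norm (x - p /\<^sub>R 2) \<le> R"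
      using that sf[of "x + p /\<^sub>R 2"] sg[of "x - p /\<^sub>R 2"] by force+
    have "2 *\<^sub>R x = (x + p /\<^sub>R 2) + (x - p /\<^sub>R 2)" "p = (x + p /\<^sub>R 2) - (x - p /\<^sub>R 2)"
      by (simp_all add: scaleR_2 flip: scaleR_left.add)
    then have "norm (2 *\<^sub>R x) \<le> 2 * R" "norm p \<le> 2 * R"
      using norm_triangle_ineq[of "x + p /\<^sub>R 2" "x - p /\<^sub>R 2"]
        norm_triangle_ineq4[of "x + p /\<^sub>R 2" "x - p /\<^sub>R 2"] * by (metis (no_types) add_mono mult_2 order_trans)+
    then show ?thesis by simp
  qed
  show "integrable lborel (\<lambda>p. f (x + p /\<^sub>R 2) * g (x - p /\<^sub>R 2))" for x
  proof (rule integrable_compact_support[of _ "2 * R"])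
    show "continuous_on UNIV (\<lambda>p. f (x + p /\<^sub>R 2) * g (x - p /\<^sub>R 2))"
      by (intro continuous_intros c)
  qed (use supp[of x] in force)
  have int1: "integrable (lborel \<Otimes>\<^sub>M lborel) (\<lambda>(x, p). f (x + p /\<^sub>R 2) * g (x - p /\<^sub>R 2))"
    unfolding lborel_prod
  proof (rule integrable_compact_support[of _ "3 * R"])
    show "continuous_on UNIV (\<lambda>(x, p). f (x + p /\<^sub>R 2) * g (x - p /\<^sub>R 2))"
      unfolding case_prod_beta by (intro continuous_intros c)
    fix z :: "'a \<times> 'a" assume z: "norm z > 3 * R"
    then show "(case z of (x, p) \<Rightarrow> f (x + p /\<^sub>R 2) * g (x - p /\<^sub>R 2)) = 0"
      using norm_Pair_le[of "fst z" "snd z"] supp[of "fst z" "snd z"] by (cases z) force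
  qed
  show "integrable lborel (\<lambda>x. \<integral>p. f (x + p /\<^sub>R 2) * g (x - p /\<^sub>R 2) \<partial>lborel)"
    using lborel_pair.integrable_fst[OF int1] .
  have int2: "integrable (lborel \<Otimes>\<^sub>M lborel) (\<lambda>(x, p). f (x + p) * g x)"
    unfolding lborel_prod
  proof (rule integrable_compact_support[of _ "3 * R"])
    show "continuous_on UNIV (\<lambda>(x, p). f (x + p) * g x)"
      unfolding case_prod_beta by (intro continuous_intros c)
    fix z :: "'a \<times> 'a" assume "norm z > 3 * R"
    moreover have "norm (fst z) \<le> R \<Longrightarrow> norm (fst z + snd z) \<le> R \<Longrightarrow> norm (snd z) \<le> 2 * R"
      using norm_triangle_ineq4[of "fst z + snd z" "fst z"] by simp
    ultimately show "(case z of (x, p) \<Rightarrow> f (x + p) * g x) = 0"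
      using norm_Pair_le[of "fst z" "snd z"] sf[of "fst z + snd z"] sg[of "fst z"] by (cases z) force
  qed
  have "(\<integral>x. (\<integral>p. f (x + p /\<^sub>R 2) * g (x - p /\<^sub>R 2) \<partial>lborel) \<partial>lborel)
      = (\<integral>p. (\<integral>x. f (x + p /\<^sub>R 2) * g (x - p /\<^sub>R 2) \<partial>lborel) \<partial>lborel)"
    by (rule lborel_pair.Fubini_integral[OF int1, symmetric])
  \<comment> \<open>For fixed \<open>p\<close>, the inner integral is translated by
    \<open>p/2\<close>.\<close>
  also have "\<dots> = (\<integral>p. (\<integral>x. f (x + p) * g x \<partial>lborel) \<partial>lborel)"
  proof (rule Bochner_Integration.integral_cong[OF refl])
    fix p :: 'a
    have "p /\<^sub>R 2 + p /\<^sub>R 2 = p" by (simp flip: scaleR_left.add)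
    then show "(\<integral>x. f (x + p /\<^sub>R 2) * g (x - p /\<^sub>R 2) \<partial>lborel) = (\<integral>x. f (x + p) * g x \<partial>lborel)"
      using lborel_integral_shift[of "\<lambda>x. f (x + p /\<^sub>R 2) * g (x - p /\<^sub>R 2)" "p /\<^sub>R 2"]
      by (simp add: add.assoc)
  qed
  also have "\<dots> = (\<integral>x. (\<integral>p. f (x + p) * g x \<partial>lborel) \<partial>lborel)"
    by (rule lborel_pair.Fubini_integral[OF int2])
  also have "\<dots> = (\<integral>x. (\<integral>p. f p \<partial>lborel) * g x \<partial>lborel)"
    using lborel_integral_shift[of f] by (simp add: add.commute)
  finally show "(\<integral>x. (\<integral>p. f (x + p /\<^sub>R 2) * g (x - p /\<^sub>R 2) \<partial>lborel) \<partial>lborel) =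
           (\<integral>x. f x \<partial>lborel) * (\<integral>x. g x \<partial>lborel)" by simp
qed

section \<open>Quaternion-valued square-integrable functions and their pairing\<close>

lemma norm_qcnj [simp]: "norm (qcnj q) = norm q"
  by (simp add: norm_quat_def)

lemma qcnj_of_real [simp]: "qcnj (of_real a) = of_real a"
  by (simp add: quat_eq_iff of_real_def)

lemma Lp_norm_2: "Lp_norm 2 f = sqrt (\<integral>x. (norm (f x))\<^sup>2 \<partial>lborel)"
  by (simp add: Lp_norm_def powr_half_sqrt)

lemma Lp_space_2_iff: "f \<in> Lp_space 2 \<longleftrightarrow>
    f \<in> borel_measurable borel \<and> integrable lborel (\<lambda>x. (norm (f x))\<^sup>2)"
  by (simp add: Lp_space_def)

text \<open>The quaternion norm is multiplicative and invariant under conjugation, so the inequality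
  for nonnegative functions applies to the moduli.\<close>

lemma pairing_Cauchy_Schwarz:
  assumes "f \<in> Lp_space 2" "g \<in> Lp_space 2"
  shows "norm (pairing f g) \<le> Lp_norm 2 f * Lp_norm 2 g"
proof (cases "integrable lborel (\<lambda>x. f x * qcnj (g x))")
  case True
  have [measurable]: "f \<in> borel_measurable borel" "g \<in> borel_measurable borel"
    and i: "integrable lborel (\<lambda>x. (norm (f x))\<^sup>2)" "integrable lborel (\<lambda>x. (norm (g x))\<^sup>2)"
    using assms by (auto simp: Lp_space_2_iff)
  have "ennreal (norm (pairing f g)) \<le> (\<integral>\<^sup>+x. ennreal (norm (f x)) * ennreal (norm (g x)) \<partial>lborel)"
    unfolding pairing_def
    using integral_norm_bound_ennreal[OF True] by (simp add: norm_mult ennreal_mult)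
  then have "(ennreal (norm (pairing f g)))\<^sup>2 \<le> (\<integral>\<^sup>+x. ennreal (norm (f x)) * ennreal (norm (g x)) \<partial>lborel)\<^sup>2"
    by (rule power_mono) simp
  also have "\<dots> \<le> (\<integral>\<^sup>+x. (ennreal (norm (f x)))\<^sup>2 \<partial>lborel) * (\<integral>\<^sup>+x. (ennreal (norm (g x)))\<^sup>2 \<partial>lborel)"
    by (rule Cauchy_Schwarz_nn_integral) auto
  also have "\<dots> = ennreal ((\<integral>x. (norm (f x))\<^sup>2 \<partial>lborel) * (\<integral>x. (norm (g x))\<^sup>2 \<partial>lborel))"
    using i by (simp add: ennreal_power nn_integral_eq_integral ennreal_mult)
  finally have "(norm (pairing f g))\<^sup>2 \<le> (\<integral>x. (norm (f x))\<^sup>2 \<partial>lborel) * (\<integral>x. (norm (g x))\<^sup>2 \<partial>lborel)"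
    by (simp add: ennreal_power)
  then show ?thesis
    unfolding Lp_norm_2 real_sqrt_mult[symmetric] by (rule real_le_rsqrt)
\<comment> \<open>In the remaining case the Bochner integral has its default value 0.\<close>
qed (simp add: pairing_def not_integrable_integral_eq Lp_norm_2)

section \<open>The modulus of the symbol\<close>

text \<open>A product over coordinates rather than a radial function, so that its integral splits
  into integrals over half-lines.\<close>

definition weight :: "real \<Rightarrow> 'a::euclidean_space \<Rightarrow> real" where
  "weight s x = (\<Prod>b\<in>Basis. indicator {0..} (x \<bullet> b) * (1 + x \<bullet> b) powr (- s))"

lemma weight_measurable [measurable]: "weight s \<in> borel_measurable borel"
  unfolding weight_def[abs_def] by measurable

lemma weight_nonneg: "0 \<le> weight s x"
  by (simp add: weight_def prod_nonneg)

lemma weight_powr: "weight s x powr r = weight (s * r) x"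
  unfolding weight_def
  by (subst prod_powr_distrib) (auto simp: powr_powr indicator_def intro!: prod.cong)

lemma weight_le_1: "0 \<le> s \<Longrightarrow> weight s x \<le> 1"
  unfolding weight_def
  by (rule prod_le_1) (auto simp: indicator_def powr_minus_divide ge_one_powr_ge_zero)

text \<open>Each factor is nonincreasing in its coordinate, so over the cube the smallest value is
  at the far corner.\<close>

lemma weight_lower:
  fixes x :: "'a::euclidean_space"
  assumes "0 \<le> s" "\<And>b. b \<in> Basis \<Longrightarrow> 0 \<le> x \<bullet> b" "\<And>b. b \<in> Basis \<Longrightarrow> x \<bullet> b \<le> a"
  shows "((1 + a) powr (- s)) ^ DIM('a) \<le> weight s x"
proof -
  have "(\<Prod>b\<in>(Basis::'a set). (1 + a) powr (- s)) \<le> weight s x"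
    unfolding weight_def
  proof (rule prod_mono)
    fix b :: 'a assume b: "b \<in> Basis"
    have "(1 + a) powr (- s) \<le> (1 + x \<bullet> b) powr (- s)"
      using assms(2,3)[OF b] assms(1) by (intro powr_mono2') auto
    then show "0 \<le> (1 + a) powr (- s) \<and>
        (1 + a) powr (- s) \<le> indicator {0..} (x \<bullet> b) * (1 + x \<bullet> b) powr (- s)"
      using assms(2)[OF b] by simp
  qed
  then show ?thesis by simp
qed

text \<open>By Tonelli the integral is a power of the integral of \<open>(1 + x) powr (- t)\<close>
  over the half-line, which equals \<open>1 / (t - 1)\<close>.\<close>

lemma integrable_weight:
  assumes "1 < t"
  shows "integrable lborel (weight t :: 'a::euclidean_space \<Rightarrow> real)"
proof (rule integrableI_bounded)
  have *: "(\<integral>\<^sup>+x. ennreal (indicator {0..} x * (1 + x) powr (- t)) \<partial>lborel) < \<infinity>"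
  proof -
    let ?F = "\<lambda>x. (1 + x) powr (1 - t) / (1 - t)"
    have "(\<integral>\<^sup>+x. ennreal ((1 + x) powr (- t)) * indicator {0..} x \<partial>lborel) = ennreal (0 - ?F 0)"
    proof (rule nn_integral_FTC_atLeast)
      show "(?F has_real_derivative (1 + x) powr (- t)) (at x)" if "0 \<le> x" for x
      proof -
        have "((\<lambda>x. 1 + x) has_real_derivative 1) (at x)" by (auto intro!: derivative_eq_intros)
        then have "((\<lambda>x. (1 + x) powr (1 - t)) has_real_derivative (1 - t) * (1 + x) powr (1 - t - 1) * 1) (at x)"
          using that by (intro DERIV_chain2[OF has_real_derivative_powr]) auto
        from DERIV_cdivide[OF this, of "1 - t"] show ?thesis using assms by simp
      qed
      have "((\<lambda>x::real. (1 + x) powr (1 - t)) \<longlongrightarrow> 0) at_top"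
        by (rule tendsto_neg_powr) (use assms in \<open>auto intro!: filterlim_tendsto_add_at_top[OF tendsto_const] filterlim_ident\<close>)
      then show "(?F \<longlongrightarrow> 0) at_top"
        using tendsto_divide_zero by blast
    qed auto
    then show ?thesis
      by (subst nn_integral_cong[where v="\<lambda>x. ennreal ((1 + x) powr (- t)) * indicator {0..} x"])
        (auto simp: indicator_def)
  qed
  have "(\<integral>\<^sup>+x. ennreal (norm (weight t (x::'a))) \<partial>lborel) =
      (\<integral>\<^sup>+x. (\<Prod>b\<in>Basis. ennreal (indicator {0..} (x \<bullet> b) * (1 + x \<bullet> b) powr (- t))) \<partial>(lborel::'a measure))"
    by (simp add: weight_nonneg) (simp add: weight_def prod_ennreal)
  also have "\<dots> = (\<Prod>b\<in>(Basis::'a set). (\<integral>\<^sup>+x. ennreal (indicator {0..} x * (1 + x) powr (- t)) \<partial>lborel))"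
    by (rule nn_integral_lborel_prod) auto
  also have "\<dots> < \<infinity>"
    using * by (simp add: power_less_top_ennreal)
  finally show "(\<integral>\<^sup>+x. ennreal (norm (weight t (x::'a))) \<partial>lborel) < \<infinity>" .
qed measurable

section \<open>Quaternionic exponentials\<close>

text \<open>Euler's formula for any square root \<open>A\<close> of -1: the product of
  \<open>exp (t A)\<close> with \<open>cos t - sin t A\<close>, the candidate for its inverse, has
  derivative 0 and is 1 at \<open>t = 0\<close>.\<close>

lemma exp_scaleR_imaginary:
  fixes A :: "'a::{real_normed_algebra_1,banach}"
  assumes "A * A = -1"
  shows "exp (t *\<^sub>R A) = of_real (cos t) + sin t *\<^sub>R A"
proof -
  let ?y = "\<lambda>t. exp (t *\<^sub>R A) * (of_real (cos t) - sin t *\<^sub>R A)"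
  have y0: "(?y has_vector_derivative 0) (at t within UNIV)" for t
  proof -
    have "((\<lambda>t. of_real (cos t) - sin t *\<^sub>R A) has_vector_derivative
        (of_real (- sin t) - cos t *\<^sub>R A)) (at t)"
      by (auto intro!: derivative_eq_intros has_vector_derivative_of_real simp: has_real_derivative_iff_has_vector_derivative[symmetric])
    from has_vector_derivative_mult[OF exp_scaleR_has_vector_derivative_right this]
    have "(?y has_vector_derivative (exp (t *\<^sub>R A) * (of_real (- sin t) - cos t *\<^sub>R A) +
        exp (t *\<^sub>R A) * A * (of_real (cos t) - sin t *\<^sub>R A))) (at t)" by simp
    moreover have "A * (of_real (cos t) - sin t *\<^sub>R A) = - (of_real (- sin t) - cos t *\<^sub>R A)"
      by (simp add: right_diff_distrib assms of_real_def)
    ultimately show ?thesis by (simp only: mult.assoc mult_minus_right add.right_inverse)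
  qed
  obtain c where c: "?y t = c" for t
    by (rule has_vector_derivative_zero_constant[of UNIV ?y]) (auto intro: y0)
  have "c = 1" using c[of 0] by simp
  have sq: "(of_real (cos t) - sin t *\<^sub>R A) * (of_real (cos t) + sin t *\<^sub>R A) = 1"
  proof -
    have "(of_real (cos t) - sin t *\<^sub>R A) * (of_real (cos t) + sin t *\<^sub>R A) =
        (cos t * cos t + sin t * sin t) *\<^sub>R 1"
      by (simp add: ring_distribs assms of_real_def scaleR_right_distrib scaleR_right_diff_distrib
          scaleR_left_distrib mult.commute del: sin_cos_squared_add3)
    then show ?thesis by simp
  qed
  have "exp (t *\<^sub>R A) = ?y t * (of_real (cos t) + sin t *\<^sub>R A)"
    unfolding mult.assoc sq by simp
  then show ?thesis unfolding c \<open>c = 1\<close> by simp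
qed

lemma exp_qi: "exp (t *\<^sub>R qi) = Quat (cos t) (sin t) 0 0"
  by (simp add: exp_scaleR_imaginary quat_unit_relations quat_eq_iff of_real_def qi_def)

lemma exp_qj: "exp (t *\<^sub>R qj) = Quat (cos t) 0 (sin t) 0"
  by (simp add: exp_scaleR_imaginary quat_unit_relations quat_eq_iff of_real_def qj_def)

lemma norm_exp_qi [simp]: "norm (exp (t *\<^sub>R qi)) = 1"
  and norm_exp_qj [simp]: "norm (exp (t *\<^sub>R qj)) = 1"
  by (simp_all add: exp_qi exp_qj norm_quat_def)

text \<open>Cyclicity of the real part moves the left \<open>j\<close>-phase to the right end, where
  it merges with the other one, while the two \<open>i\<close>-phases are already adjacent. The real
  part of \<open>(cos \<alpha> + sin \<alpha> i) (cos \<beta> + sin \<beta> j)\<close> is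
  \<open>cos \<alpha> cos \<beta>\<close>.\<close>

lemma qRe_phases:
  "qRe ((exp (b *\<^sub>R qj) * exp (a *\<^sub>R qi)) *
        (exp (a' *\<^sub>R qi) * of_real u * qcnj (of_real v) * exp (b' *\<^sub>R qj))) =
    cos (a + a') * cos (b + b') * (u * v)"
  by (simp add: exp_qi exp_qj of_real_def cos_add algebra_simps)

lemma bounded_linear_qRe: "bounded_linear qRe"
proof (rule bounded_linear_intro[of _ 1])
  show "norm (qRe x) \<le> norm x * 1" for x
    by (simp add: norm_quat_def) (intro real_le_rsqrt, simp)
qed auto

section \<open>The test functions and the symbol\<close>

abbreviation bump :: "real \<Rightarrow> real" where "bump \<equiv> bump_fam 1 0"

lemma bump_nonneg: "0 \<le> bump t"
  and bump_le_1: "bump t \<le> 1"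
  and bump_eq_0_iff: "bump t = 0 \<longleftrightarrow> \<not> (0 < t \<and> t < 1)"
  by (auto simp: bump_fam_def)

text \<open>With spacing 2, the midpoints of a point of the \<open>j\<close>-th tooth and a point of
  (0, 1) lie in (j, j + 1), so different teeth give disjoint midpoint cells.\<close>

definition comb :: "nat \<Rightarrow> real \<Rightarrow> real" where
  "comb N t = (\<Sum>j<N. bump (t - 2 * real j))"

lemma comb_nonneg: "0 \<le> comb N t"
  by (simp add: comb_def sum_nonneg bump_nonneg)

lemma comb_nonzeroE:
  assumes "comb N t \<noteq> 0"
  obtains j where "j < N" "2 * real j < t" "t < 2 * real j + 1"
proof -
  obtain j where "j < N" "bump (t - 2 * real j) \<noteq> 0"
    using assms unfolding comb_def by (metis lessThan_iff sum.not_neutral_contains_not_neutral)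
  then show ?thesis by (intro that) (auto simp: bump_eq_0_iff)
qed

text \<open>The teeth have disjoint supports, so at most one summand is nonzero.\<close>

lemma comb_le_1: "comb N t \<le> 1"
proof (cases "comb N t = 0")
  case False
  then obtain j where j: "j < N" "2 * real j < t" "t < 2 * real j + 1" by (rule comb_nonzeroE)
  have "bump (t - 2 * real i) = 0" if "i \<noteq> j" for i
    using j that unfolding bump_eq_0_iff by linarith
  then have "comb N t = (\<Sum>i\<in>{j}. bump (t - 2 * real i))"
    unfolding comb_def using j(1) by (intro sum.mono_neutral_right) auto
  then show ?thesis by (simp add: bump_le_1)
qed simp

definition comb1 :: "nat \<Rightarrow> real^2 \<Rightarrow> real" where
  "comb1 N x = comb N (x$1) * bump (x$2)"

definition comb2 :: "nat \<Rightarrow> real^2 \<Rightarrow> real" where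
  "comb2 N x = bump (x$1) * comb N (x$2)"

lemma comb1_nonneg: "0 \<le> comb1 N x" and comb2_nonneg: "0 \<le> comb2 N x"
  by (simp_all add: comb1_def comb2_def comb_nonneg bump_nonneg)

lemma comb1_le_1: "comb1 N x \<le> 1" and comb2_le_1: "comb2 N x \<le> 1"
  by (simp_all add: comb1_def comb2_def mult_le_one comb_nonneg bump_nonneg comb_le_1 bump_le_1)

lemma test_fun_comb: "test_fun (comb N)"
  using test_fun_sum_shift[OF test_fun_bump_fam] by (simp add: comb_def[abs_def])

lemma schwartz_comb:
  "(\<lambda>x. of_real (comb1 N x) :: quat) \<in> schwartz" "(\<lambda>x. of_real (comb2 N x) :: quat) \<in> schwartz"
  unfolding comb1_def comb2_def
  by (rule schwartz_tensor[OF test_fun_comb test_fun_bump_fam])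
    (rule schwartz_tensor[OF test_fun_bump_fam test_fun_comb])

lemma continuous_test_fun_component:
  "test_fun u \<Longrightarrow> continuous_on UNIV (\<lambda>x::real^2. u (x$i))"
  by (rule continuous_on_compose2[OF test_fun_continuous[of u UNIV]]) (auto intro!: continuous_intros)

lemma continuous_comb: "continuous_on UNIV (comb1 N)" "continuous_on UNIV (comb2 N)"
  unfolding comb1_def[abs_def] comb2_def[abs_def]
  by (intro continuous_on_mult continuous_test_fun_component test_fun_comb test_fun_bump_fam)+

lemma comb_measurable [measurable]:
  "comb1 N \<in> borel_measurable borel" "comb2 N \<in> borel_measurable borel"
  by (intro borel_measurable_continuous_onI continuous_comb)+

lemma comb_support:
  assumes "norm x > 2 * real N + 2"
  shows "comb1 N x = 0" "comb2 N x = 0"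
proof -
  have c: "\<bar>t\<bar> \<le> 2 * real N" if nz: "comb N t \<noteq> 0" for t
  proof -
    obtain j where "j < N" "2 * real j < t" "t < 2 * real j + 1" using nz by (rule comb_nonzeroE)
    then show ?thesis by linarith
  qed
  have b: "\<bar>t\<bar> \<le> 1" if "bump t \<noteq> 0" for t using that by (auto simp: bump_eq_0_iff)
  show "comb1 N x = 0" "comb2 N x = 0"
    unfolding comb1_def comb2_def mult_eq_0_iff
    using norm_le_R2[of x] c b assms by (smt (verit, ccfv_threshold))+
qed

lemma integrable_comb: "integrable lborel (comb1 N)" "integrable lborel (comb2 N)"
  by (rule integrable_compact_support[of _ "2 * real N + 2"]; simp add: continuous_comb comb_support)+

section \<open>Integrals and square norms of the two combs\<close>

definition mass :: real where
  "mass = (\<integral>x. bump (x$1) * bump (x$2) \<partial>(lborel :: (real^2) measure))"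

text \<open>Makes the continuity and integrability facts about combs available for a single
  bump.\<close>

lemma bump2_eq_comb: "bump (x$1) * bump (x$2) = comb1 1 x"
  by (simp add: comb1_def comb_def)

text \<open>A nonnegative function with integral 0 vanishes almost everywhere, but this one is
  positive on the open unit square, which has measure 1.\<close>

lemma mass_pos: "0 < mass"
proof -
  have i: "integrable lborel (\<lambda>x::real^2. bump (x$1) * bump (x$2))"
    unfolding bump2_eq_comb using integrable_comb by simp
  have "mass \<noteq> 0"
  proof
    assume "mass = 0"
    then have "AE x::real^2 in lborel. bump (x$1) * bump (x$2) = 0"
      unfolding mass_def using integral_nonneg_eq_0_iff_AE[OF i] by (simp add: bump_nonneg)
    then have "AE x::real^2 in lborel. x \<notin> box 0 1"
      by (rule AE_mp) (auto simp: bump_eq_0_iff mem_box_cart)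
    then have "emeasure lborel (box 0 (1::real^2)) = 0"
      by (subst (asm) AE_iff_measurable[of "box 0 1"]) auto
    moreover have "(\<Prod>b\<in>Basis. (1 - 0 :: real^2) \<bullet> b) = 1"
      by (rule prod.neutral) (auto simp: Basis_vec_def inner_axis)
    then have "emeasure lborel (box 0 (1::real^2)) = 1"
      by (subst emeasure_lborel_box) (auto simp: Basis_vec_def inner_axis)
    ultimately show False by simp
  qed
  moreover have "0 \<le> mass"
    unfolding mass_def by (simp add: bump_nonneg)
  ultimately show ?thesis by simp
qed

lemma integral_comb:
  "(\<integral>x. comb1 N x \<partial>lborel) = real N * mass" "(\<integral>x. comb2 N x \<partial>lborel) = real N * mass"
proof -
  let ?b = "\<lambda>x::real^2. bump (x$1) * bump (x$2)"
  have shift: "integrable lborel (\<lambda>x. ?b (x + a))" "(\<integral>x. ?b (x + a) \<partial>lborel) = mass" for a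
  proof -
    have "integrable lborel (\<lambda>x. comb1 1 (x + a))"
    proof (rule integrable_compact_support)
      show "continuous_on UNIV (\<lambda>x. comb1 1 (x + a))"
        by (rule continuous_on_compose2[OF continuous_comb(1)]) (auto intro!: continuous_intros)
      \<comment> \<open>The 4 is \<open>2 * N + 2\<close> from \<open>comb_support\<close> at
        \<open>N = 1\<close>.\<close>
      show "comb1 1 (x + a) = 0" if "norm x > 4 + norm a" for x
        using that norm_triangle_ineq4[of "x + a" a] by (intro comb_support) simp
    qed
    then show "integrable lborel (\<lambda>x. ?b (x + a))" unfolding bump2_eq_comb .
    show "(\<integral>x. ?b (x + a) \<partial>lborel) = mass"
      unfolding bump2_eq_comb mass_def by (rule lborel_integral_shift) measurable
  qed
  have "comb1 N = (\<lambda>x. \<Sum>j<N. ?b (x + axis 1 (- 2 * real j)))"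
       "comb2 N = (\<lambda>x. \<Sum>j<N. ?b (x + axis 2 (- 2 * real j)))"
    by (simp_all add: comb1_def comb2_def comb_def sum_distrib_left sum_distrib_right axis_def fun_eq_iff)
  then show "(\<integral>x. comb1 N x \<partial>lborel) = real N * mass" "(\<integral>x. comb2 N x \<partial>lborel) = real N * mass"
    by (simp_all only: Bochner_Integration.integral_sum[OF shift(1)] shift(2)) simp_all
qed

text \<open>Values in [0, 1] give \<open>(f x)^2 \<le> f x\<close>, so the integral of
  \<open>f\<close> bounds the squared norm.\<close>

lemma L2_comb:
  fixes f :: "real^2 \<Rightarrow> real"
  assumes "f \<in> {comb1 N, comb2 N}"
  shows "(\<lambda>x. of_real (f x)) \<in> Lp_space 2"
    and "Lp_norm 2 (\<lambda>x. of_real (f x)) \<le> sqrt (real N * mass)"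
proof -
  have f: "integrable lborel f" "(\<integral>x. f x \<partial>lborel) = real N * mass" "\<And>x. 0 \<le> f x" "\<And>x. f x \<le> 1"
    "f \<in> borel_measurable borel"
    using assms by (auto simp: integrable_comb integral_comb comb1_nonneg comb2_nonneg comb1_le_1 comb2_le_1
        simp del: One_nat_def)
  note [measurable] = f(5)
  have le: "(f x)\<^sup>2 \<le> f x" for x
    using f(3,4)[of x] by (simp add: power2_eq_square mult_left_le)
  have i: "integrable lborel (\<lambda>x. (f x)\<^sup>2)"
    by (rule Bochner_Integration.integrable_bound[OF f(1)]) (auto simp: le f(3))
  then show "(\<lambda>x. of_real (f x)) \<in> Lp_space 2"
    by (simp add: Lp_space_2_iff)
  have "(\<integral>x. (f x)\<^sup>2 \<partial>lborel) \<le> real N * mass"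
    unfolding f(2)[symmetric] by (rule integral_mono[OF i f(1) le])
  then show "Lp_norm 2 (\<lambda>x. of_real (f x)) \<le> sqrt (real N * mass)"
    by (simp add: Lp_norm_2)
qed

text \<open>If \<open>x + p/2\<close> lies over tooth \<open>j\<close> of \<open>comb1\<close> and
  \<open>x - p/2\<close> over tooth \<open>k\<close> of \<open>comb2\<close>, then half sums put
  \<open>x\<close> in the unit cell with corner \<open>(j, k)\<close> and differences put
  \<open>p\<close> within 1 of \<open>(2 j, - 2 k)\<close> in each coordinate. The sign in the
  second coordinate is negative because there the comb sits at \<open>x - p/2\<close>.\<close>

lemma comb_midpoint_cell:
  assumes "comb1 N (x + p /\<^sub>R 2) * comb2 N (x - p /\<^sub>R 2) \<noteq> 0"
  shows "0 \<le> x$i" "x$i \<le> real N" "\<bar>p$1 - 2 * \<lfloor>x$1\<rfloor>\<bar> < 1" "\<bar>p$2 + 2 * \<lfloor>x$2\<rfloor>\<bar> < 1"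
proof -
  have nz: "comb N (x$1 + p$1 / 2) \<noteq> 0" "bump (x$2 + p$2 / 2) \<noteq> 0"
    "bump (x$1 - p$1 / 2) \<noteq> 0" "comb N (x$2 - p$2 / 2) \<noteq> 0"
    using assms by (auto simp: comb1_def comb2_def)
  obtain j where j: "j < N" "2 * real j < x$1 + p$1 / 2" "x$1 + p$1 / 2 < 2 * real j + 1"
    using nz(1) by (rule comb_nonzeroE)
  obtain k where k: "k < N" "2 * real k < x$2 - p$2 / 2" "x$2 - p$2 / 2 < 2 * real k + 1"
    using nz(4) by (rule comb_nonzeroE)
  have b: "0 < x$2 + p$2 / 2" "x$2 + p$2 / 2 < 1" "0 < x$1 - p$1 / 2" "x$1 - p$1 / 2 < 1"
    using nz by (auto simp: bump_eq_0_iff)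
  have x: "real j < x$1" "x$1 < real j + 1" "real k < x$2" "x$2 < real k + 1"
    using j k b by (auto simp: field_simps)
  then have fl: "\<lfloor>x$1\<rfloor> = int j" "\<lfloor>x$2\<rfloor> = int k" by linarith+
  show "\<bar>p$1 - 2 * \<lfloor>x$1\<rfloor>\<bar> < 1" "\<bar>p$2 + 2 * \<lfloor>x$2\<rfloor>\<bar> < 1"
    unfolding fl using j k b by (auto simp: abs_less_iff field_simps)
  have "0 \<le> x$1 \<and> x$1 \<le> real N \<and> 0 \<le> x$2 \<and> x$2 \<le> real N"
    using x j(1) k(1) by linarith
  then show "0 \<le> x$i" "x$i \<le> real N"
    using exhaust_2[of i] by auto
qed

text \<open>On the cell where \<open>\<lfloor>x\<^sub>1\<rfloor> = j\<close> and \<open>\<lfloor>x\<^sub>2\<rfloor> = k\<close>, only the \<open>j\<close>-th bump of \<open>comb1\<close> and the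
  \<open>k\<close>-th bump of \<open>comb2\<close> contribute to the Wigner transform, with a phase in \<open>i\<close> on the left and a
  phase in \<open>j\<close> on the right. The symbol multiplies from the left only, but it can undo both phases in
  the real part, because \<open>qRe (a * b) = qRe (b * a)\<close>.\<close>

definition symbol :: "real \<Rightarrow> (real^2) \<times> (real^2) \<Rightarrow> quat" where
  "symbol s z = (weight s (fst z) * indicator (ball 0 (1/6)) (snd z)) *\<^sub>R
     (exp ((- 4 * pi * snd z$2 * \<lfloor>fst z$2\<rfloor>) *\<^sub>R qj) * exp ((4 * pi * snd z$1 * \<lfloor>fst z$1\<rfloor>) *\<^sub>R qi))"

lemma norm_symbol: "norm (symbol s z) = weight s (fst z) * indicator (ball 0 (1/6)) (snd z)"
  unfolding symbol_def norm_scaleR norm_mult norm_exp_qi norm_exp_qj by (simp add: weight_nonneg)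

lemma exp_scaleR_measurable [measurable (raw)]:
  fixes A :: quat
  assumes "h \<in> borel_measurable M"
  shows "(\<lambda>x. exp (h x *\<^sub>R A)) \<in> borel_measurable M"
proof (rule measurable_compose[OF assms])
  show "(\<lambda>t. exp (t *\<^sub>R A)) \<in> borel_measurable borel"
    using has_vector_derivative_continuous[OF exp_scaleR_has_vector_derivative_right[of A]]
    by (intro borel_measurable_continuous_onI) (auto simp: continuous_on_eq_continuous_within)
qed

lemma vec_nth_measurable [measurable (raw)]:
  fixes h :: "'a \<Rightarrow> real^2"
  shows "h \<in> borel_measurable M \<Longrightarrow> (\<lambda>x. h x $ i) \<in> borel_measurable M"
  by (rule measurable_compose) (auto intro!: borel_measurable_continuous_onI continuous_intros)

lemma symbol_measurable [measurable]: "symbol s \<in> borel_measurable (lborel \<Otimes>\<^sub>M lborel)"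
proof -
  have [measurable]: "ball (0::real^2) (1/6) \<in> sets borel" by simp
  show ?thesis unfolding symbol_def[abs_def] by measurable
qed

lemma indicator_powr: "(indicator A x :: real) powr r = indicator A x"
  by (simp add: indicator_def)

text \<open>The phases have modulus 1, so the \<open>r\<close>-th power of the modulus is an
  integrable weight in \<open>x\<close>, of exponent \<open>s * r > 1\<close>, times the indicator
  of a ball in \<xi>.\<close>

lemma symbol_in_Lp:
  assumes "1 < s * r"
  shows "symbol s \<in> Lp_space r"
proof -
  have "(\<lambda>z. norm (symbol s z) powr r) =
      (\<lambda>z. weight (s * r) (fst z) * indicator (ball 0 (1/6)) (snd z))"
    by (simp add: norm_symbol powr_mult weight_nonneg weight_powr indicator_powr)
  moreover have "integrable (lborel \<Otimes>\<^sub>M lborel)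
      (\<lambda>z. weight (s * r) (fst z :: real^2) * indicator (ball 0 (1/6)) (snd z :: real^2))"
    by (intro integrable_lborel_pair_mult integrable_weight assms integrable_real_indicator)
      (simp_all add: emeasure_lborel_ball_finite[unfolded infinity_ennreal_def])
  ultimately show ?thesis
    using symbol_measurable[of s] by (simp add: Lp_space_def lborel_prod)
qed

section \<open>The lower bound\<close>

text \<open>The radius 1/6 in \<open>symbol\<close> is chosen so that the phases left after
  cancellation stay within pi/3.\<close>

lemma half_le_cos_product:
  fixes a c :: real
  assumes "\<bar>a\<bar> < 1/6" "\<bar>c\<bar> < 1"
  shows "1/2 \<le> cos (2 * pi * a * c)"
proof -
  have "\<bar>a * c\<bar> \<le> 1/6 * 1"
    unfolding abs_mult using assms by (intro mult_mono) auto
  then have "2 * pi * \<bar>a * c\<bar> \<le> 2 * pi * (1/6)"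
    by (intro mult_left_mono) auto
  then have "\<bar>2 * pi * a * c\<bar> \<le> pi / 3"
    by (simp add: abs_mult mult.assoc)
  then have "cos (pi / 3) \<le> cos \<bar>2 * pi * a * c\<bar>"
    by (intro cos_monotone_0_pi_le) (auto simp: field_simps)
  then show ?thesis by (simp add: cos_60)
qed

text \<open>The real part of symbol times Wigner integrand is bounded below pointwise by a multiple
  of its modulus \<open>K\<close>, and then integrated over \<open>p\<close>, \<open>x\<close> and
  \<xi>. In the constant, the square comes from the two factors of \<open>weight\<close> and 1/4
  from the two cosines.\<close>

lemma weyl_form_lower_bound:
  assumes s: "0 \<le> s"
  shows "((1 + real N) powr (- s))\<^sup>2 / 4 * measure lborel (ball 0 (1/6) :: (real^2) set) * (real N * mass)\<^sup>2
     \<le> norm (weyl_form (symbol s) (\<lambda>x. of_real (comb1 N x)) (\<lambda>x. of_real (comb2 N x)))"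
proof -
  let ?f = "\<lambda>x. of_real (comb1 N x) :: quat" and ?g = "\<lambda>x. of_real (comb2 N x) :: quat"
  let ?B = "ball 0 (1/6) :: (real^2) set"
  define c where "c = ((1 + real N) powr (- s))\<^sup>2 / 4"
  define K where "K x p = comb1 N (x + p /\<^sub>R 2) * comb2 N (x - p /\<^sub>R 2)" for x p
  define E where "E x \<xi> p = exp ((- 2 * pi * \<xi>$1 * p$1) *\<^sub>R qi) * ?f (x + p /\<^sub>R 2) * qcnj (?g (x - p /\<^sub>R 2))
           * exp ((- 2 * pi * \<xi>$2 * p$2) *\<^sub>R qj)" for x \<xi> p :: "real^2"
  define G where "G x = (\<integral>p. K x p \<partial>lborel)" for x
  define U where "U z = symbol s z * wigner ?f ?g (fst z) (snd z)" for z
  have K0: "0 \<le> K x p" for x p by (simp add: K_def comb1_nonneg comb2_nonneg)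
  have K: "integrable lborel (K x)" "integrable lborel G"
    "(\<integral>x. G x \<partial>lborel) = (real N * mass)\<^sup>2" for x
    unfolding K_def[abs_def] G_def
    using midpoint_integral[OF continuous_comb(1)[of N] continuous_comb(2)[of N] comb_support(1) comb_support(2)]
    by (simp_all add: integral_comb power2_eq_square)
  have W: "wigner ?f ?g x \<xi> = (\<integral>p. E x \<xi> p \<partial>lborel)" for x \<xi>
    by (simp add: wigner_def E_def)
  have nE: "norm (E x \<xi> p) = K x p" for x \<xi> p
    unfolding E_def K_def norm_mult norm_exp_qi norm_exp_qj by (simp add: comb1_nonneg comb2_nonneg)
  have E_meas: "(\<lambda>(z, p). E (fst z) (snd z) p) \<in> borel_measurable ((lborel \<Otimes>\<^sub>M lborel) \<Otimes>\<^sub>M lborel)"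
    unfolding E_def qcnj_of_real case_prod_beta by measurable
  have [measurable]: "E x \<xi> \<in> borel_measurable lborel" for x \<xi>
    unfolding E_def qcnj_of_real by measurable
  have E_int: "integrable lborel (E x \<xi>)" for x \<xi>
    by (rule Bochner_Integration.integrable_bound[OF K(1)[of x]]) (auto simp: nE)
  have U_meas: "U \<in> borel_measurable (lborel \<Otimes>\<^sub>M lborel)"
    unfolding U_def W
    by (intro borel_measurable_times symbol_measurable lborel.borel_measurable_lebesgue_integral E_meas)
  have GB: "integrable (lborel \<Otimes>\<^sub>M lborel) (\<lambda>z. G (fst z) * indicator ?B (snd z))"
    by (intro integrable_lborel_pair_mult K integrable_real_indicator)
      (simp_all add: emeasure_lborel_ball_finite[unfolded infinity_ennreal_def])
  \<comment> \<open>The weight is at most 1 and \<open>E\<close> has modulus \<open>K\<close>, so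
    \<open>U\<close> is dominated by an integrable product. This justifies treating the iterated
    integral in \<open>weyl_form\<close> as an integral over the product space.\<close>
  have U_int: "integrable (lborel \<Otimes>\<^sub>M lborel) U"
  proof (rule Bochner_Integration.integrable_bound[OF GB U_meas], intro AE_I2)
    fix z
    have "norm (wigner ?f ?g (fst z) (snd z)) \<le> G (fst z)"
      unfolding W G_def nE[of "fst z" "snd z", symmetric] by (rule integral_norm_bound)
    then have "norm (U z) \<le> (1 * indicator ?B (snd z)) * G (fst z)"
      unfolding U_def norm_mult norm_symbol
      by (intro mult_mono mult_right_mono weight_le_1 s) (auto simp: weight_nonneg)
    then show "norm (U z) \<le> norm (G (fst z) * indicator ?B (snd z))"
      by (simp add: mult.commute)
  qed
  have key: "c * indicator ?B \<xi> * K x p \<le> qRe (symbol s (x, \<xi>) * E x \<xi> p)" for x \<xi> p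
  proof -
    define C where "C = cos (4 * pi * \<xi>$1 * \<lfloor>x$1\<rfloor> + - 2 * pi * \<xi>$1 * p$1) *
        cos (- 4 * pi * \<xi>$2 * \<lfloor>x$2\<rfloor> + - 2 * pi * \<xi>$2 * p$2)"
    have eq: "qRe (symbol s (x, \<xi>) * E x \<xi> p) = weight s x * indicator ?B \<xi> * (C * K x p)"
      unfolding symbol_def E_def K_def C_def mult_scaleR_left scaleR_quat.simps qRe_phases by simp
    show ?thesis
    proof (cases "K x p = 0 \<or> \<xi> \<notin> ?B")
      case False
      then have nz: "comb1 N (x + p /\<^sub>R 2) * comb2 N (x - p /\<^sub>R 2) \<noteq> 0" and "norm \<xi> < 1/6"
        by (auto simp: K_def)
      note cell = comb_midpoint_cell[OF nz]
      have \<xi>: "\<bar>\<xi>$i\<bar> < 1/6" for i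
        using component_le_norm_cart[of \<xi> i] \<open>norm \<xi> < 1/6\<close> by linarith
      \<comment> \<open>The phases of the symbol recentre \<open>p\<close> at
        \<open>(2 j, - 2 k)\<close>, leaving offsets of modulus less than 1.\<close>
      have "1/2 \<le> cos (2 * pi * (- \<xi>$1) * (p$1 - 2 * \<lfloor>x$1\<rfloor>))"
        "1/2 \<le> cos (2 * pi * (- \<xi>$2) * (p$2 + 2 * \<lfloor>x$2\<rfloor>))"
        using \<xi> cell(3,4) by (intro half_le_cos_product; simp)+
      then have "1/2 * (1/2) \<le> cos (2 * pi * (- \<xi>$1) * (p$1 - 2 * \<lfloor>x$1\<rfloor>)) *
          cos (2 * pi * (- \<xi>$2) * (p$2 + 2 * \<lfloor>x$2\<rfloor>))"
        by (intro mult_mono) auto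
      then have "1/4 \<le> C" unfolding C_def by (simp add: algebra_simps)
      moreover have "0 \<le> x \<bullet> b \<and> x \<bullet> b \<le> real N" if "b \<in> Basis" for b
        using that cell(1,2) by (auto simp: Basis_vec_def inner_axis)
      then have "((1 + real N) powr (- s))\<^sup>2 \<le> weight s x"
        using weight_lower[OF s, of x "real N"] by simp
      ultimately have "((1 + real N) powr (- s))\<^sup>2 * (1/4) \<le> weight s x * C"
        by (intro mult_mono) (auto simp: weight_nonneg)
      then have "c * K x p \<le> weight s x * C * K x p"
        unfolding c_def by (intro mult_right_mono K0) simp
      then show ?thesis unfolding eq using False by simp
    next
      case True
      then show ?thesis unfolding eq by auto
    qed
  qed
  have U_lower: "c * (G (fst z) * indicator ?B (snd z)) \<le> qRe (U z)" for z
  proof -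
    obtain x \<xi> where z: "z = (x, \<xi>)" by (cases z)
    have i: "integrable lborel (\<lambda>p. symbol s (x, \<xi>) * E x \<xi> p)"
      using E_int by simp
    have "c * (G x * indicator ?B \<xi>) = (\<integral>p. c * indicator ?B \<xi> * K x p \<partial>lborel)"
      using K(1)[of x] by (simp add: G_def)
    also have "\<dots> \<le> (\<integral>p. qRe (symbol s (x, \<xi>) * E x \<xi> p) \<partial>lborel)"
      using K(1)[of x] integrable_bounded_linear[OF bounded_linear_qRe i]
      by (intro integral_mono key) auto
    also have "\<dots> = qRe (U z)"
      unfolding integral_bounded_linear[OF bounded_linear_qRe i] U_def W z
      using E_int by simp
    finally show ?thesis unfolding z by simp
  qed
  have "weyl_form (symbol s) ?f ?g = (\<integral>\<xi>. (\<integral>x. U (x, \<xi>) \<partial>lborel) \<partial>lborel)"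
    by (simp add: weyl_form_def U_def)
  also have "\<dots> = (\<integral>z. U z \<partial>(lborel \<Otimes>\<^sub>M lborel))"
    using lborel_pair.integral_snd[of "\<lambda>x \<xi>. U (x, \<xi>)"] U_int by simp
  finally have weyl: "weyl_form (symbol s) ?f ?g = (\<integral>z. U z \<partial>(lborel \<Otimes>\<^sub>M lborel))" .
  have "c * measure lborel ?B * (real N * mass)\<^sup>2 = c * (\<integral>x. (\<integral>\<xi>. G x * indicator ?B \<xi> \<partial>lborel) \<partial>lborel)"
    using K(2) by (simp add: K(3))
  also have "\<dots> = c * (\<integral>z. G (fst z) * indicator ?B (snd z) \<partial>(lborel \<Otimes>\<^sub>M lborel))"
    using lborel_pair.integral_fst'[OF GB] by simp
  also have "\<dots> = (\<integral>z. c * (G (fst z) * indicator ?B (snd z)) \<partial>(lborel \<Otimes>\<^sub>M lborel))"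
    by simp
  also have "\<dots> \<le> (\<integral>z. qRe (U z) \<partial>(lborel \<Otimes>\<^sub>M lborel))"
    using GB integrable_bounded_linear[OF bounded_linear_qRe U_int]
    by (intro integral_mono U_lower) auto
  also have "\<dots> = qRe (weyl_form (symbol s) ?f ?g)"
    unfolding weyl by (rule integral_bounded_linear[OF bounded_linear_qRe U_int])
  also have "\<dots> \<le> norm (weyl_form (symbol s) ?f ?g)"
    unfolding norm_quat_def by (rule real_le_rsqrt) simp
  finally show ?thesis unfolding c_def .
qed

text \<open>The form at the combs is at least of order \<open>N powr (2 - 2 * s)\<close>, while the
  product of the norms is at most \<open>N * mass\<close>; the quotient of these bounds diverges
  because \<open>s < 1/2\<close>.\<close>

lemma symbol_unbounded:
  assumes s: "0 \<le> s" "s < 1/2"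
  obtains N where "C * Lp_norm 2 (\<lambda>x. of_real (comb1 N x)) * Lp_norm 2 (\<lambda>x. of_real (comb2 N x))
     < norm (weyl_form (symbol s) (\<lambda>x. of_real (comb1 N x)) (\<lambda>x. of_real (comb2 N x)))"
proof -
  define b where "b = measure lborel (ball 0 (1/6) :: (real^2) set)"
  have b: "b > 0" unfolding b_def using content_ball_pos[of "1/6" "0::real^2"] by simp
  \<comment> \<open>This is the bound of \<open>weyl_form_lower_bound\<close> divided by
    \<open>n * mass\<close>.\<close>
  have "filterlim (\<lambda>n. mass * b / 4 * (((1 + real n) powr (- s))\<^sup>2 * real n)) at_top sequentially"
    using s mass_pos b by real_asymp
  \<comment> \<open>The absolute value covers a negative \<open>C\<close>; \<open>n > 0\<close>
    makes the factor \<open>N * mass\<close> positive for the strict inequality below.\<close>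
  then have "\<forall>\<^sub>F n in sequentially. mass * b / 4 * (((1 + real n) powr (- s))\<^sup>2 * real n) > \<bar>C\<bar> \<and> n > 0"
    by (intro eventually_conj eventually_gt_at_top) (simp add: filterlim_at_top_dense)
  then obtain N where N: "mass * b / 4 * (((1 + real N) powr (- s))\<^sup>2 * real N) > \<bar>C\<bar>" "N > 0"
    using eventually_happens'[OF sequentially_bot] by blast
  let ?f = "Lp_norm 2 (\<lambda>x. of_real (comb1 N x))" and ?g = "Lp_norm 2 (\<lambda>x. of_real (comb2 N x))"
  have "?f * ?g \<le> sqrt (real N * mass) * sqrt (real N * mass)"
    using mass_pos by (intro mult_mono L2_comb) (auto simp: Lp_norm_2)
  also have "\<dots> = real N * mass" using mass_pos by simp
  finally have fg: "?f * ?g \<le> real N * mass" .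
  have "C * ?f * ?g \<le> \<bar>C\<bar> * (?f * ?g)"
    unfolding mult.assoc by (intro mult_right_mono) (auto simp: Lp_norm_2)
  also have "\<dots> \<le> \<bar>C\<bar> * (real N * mass)"
    by (intro mult_left_mono fg) simp
  also have "\<dots> < mass * b / 4 * (((1 + real N) powr (- s))\<^sup>2 * real N) * (real N * mass)"
    using N mass_pos by (intro mult_strict_right_mono) auto
  also have "\<dots> = ((1 + real N) powr (- s))\<^sup>2 / 4 * b * (real N * mass)\<^sup>2"
    by (simp add: power2_eq_square)
  also have "\<dots> \<le> norm (weyl_form (symbol s) (\<lambda>x. of_real (comb1 N x)) (\<lambda>x. of_real (comb2 N x)))"
    unfolding b_def by (rule weyl_form_lower_bound[OF s(1)])
  finally show ?thesis by (rule that)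
qed

section \<open>One symbol defeating both notions of boundedness\<close>

theorem mainTheorem2:
  fixes r :: real
  assumes "2 < r"
  shows "\<not> (\<forall>\<sigma>\<in>Lp_space r. weyl_extends_bounded \<sigma>) \<and>
         \<not> (\<forall>\<sigma>\<in>Lp_space r. weyl_form_bounded \<sigma>)"
proof -
  obtain s where s: "1 / r < s" "s < 1/2"
    using dense[of "1/r" "1/2"] assms by (auto simp: field_simps)
  have "0 < 1 / r" using assms by simp
  then have s0: "0 \<le> s" using s by linarith
  have "1 < s * r" using s(1) assms by (simp add: field_simps)
  then have Lr: "symbol s \<in> Lp_space r" by (rule symbol_in_Lp)
  have "\<not> weyl_form_bounded (symbol s)"
  proof
    assume "weyl_form_bounded (symbol s)"
    then obtain C where "\<And>f g. f \<in> schwartz \<Longrightarrow> g \<in> schwartz \<Longrightarrow>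
        norm (weyl_form (symbol s) f g) \<le> C * Lp_norm 2 f * Lp_norm 2 g"
      unfolding weyl_form_bounded_def by blast
    then show False
      using symbol_unbounded[OF s0 s(2), of C] schwartz_comb by (meson not_less)
  qed
  moreover have "\<not> weyl_extends_bounded (symbol s)"
  proof
    assume "weyl_extends_bounded (symbol s)"
    then obtain T C where
      T: "\<And>f. f \<in> Lp_space 2 \<Longrightarrow> T f \<in> Lp_space 2"
        "\<And>f. f \<in> Lp_space 2 \<Longrightarrow> Lp_norm 2 (T f) \<le> C * Lp_norm 2 f"
      and rep: "\<And>f g. f \<in> schwartz \<Longrightarrow> g \<in> schwartz \<Longrightarrow> pairing (T f) g = weyl_form (symbol s) f g"
      unfolding weyl_extends_bounded_def bounded_linear_L2_def by blast
    obtain N where N: "C * Lp_norm 2 (\<lambda>x. of_real (comb1 N x)) * Lp_norm 2 (\<lambda>x. of_real (comb2 N x))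
        < norm (weyl_form (symbol s) (\<lambda>x. of_real (comb1 N x)) (\<lambda>x. of_real (comb2 N x)))"
      \<comment> \<open>The operator bound \<open>C\<close> is fixed first and \<open>N\<close>
        chosen after it. By Cauchy-Schwarz the same \<open>C\<close> would bound the form at this
        pair of combs.\<close>
      using symbol_unbounded[OF s0 s(2)] .
    have f: "(\<lambda>x. of_real (comb1 N x)) \<in> Lp_space 2" and g: "(\<lambda>x. of_real (comb2 N x)) \<in> Lp_space 2"
      by (rule L2_comb(1)[of _ N]; simp)+
    have "norm (weyl_form (symbol s) (\<lambda>x. of_real (comb1 N x)) (\<lambda>x. of_real (comb2 N x)))
        \<le> Lp_norm 2 (T (\<lambda>x. of_real (comb1 N x))) * Lp_norm 2 (\<lambda>x. of_real (comb2 N x))"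
      unfolding rep[OF schwartz_comb, symmetric] by (rule pairing_Cauchy_Schwarz[OF T(1)[OF f] g])
    also have "\<dots> \<le> C * Lp_norm 2 (\<lambda>x. of_real (comb1 N x)) * Lp_norm 2 (\<lambda>x. of_real (comb2 N x))"
      by (intro mult_right_mono T(2)[OF f]) (simp add: Lp_norm_2)
    finally show False using N by simp
  qed
  ultimately show ?thesis using Lr by blast
qed

end
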